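(* Let $k$ be a field. Up to permutation of the variables (both in the source and the target), the plane Cremona monomial group (the Cremona monomial group of $\mathbb{P}^2$ over $k$) is generated by the maps $S=(x_1x_2,\,x_1x_3,\,x_2x_3)$ and $H=(x_1^2,\,x_1x_2,\,x_2x_3)$. That is, the group of Cremona monomial maps of $\mathbb{P}^2$ under composition is generated by $S$, $H$ and the permutation maps $(x_{\sigma(1)},x_{\sigma(2)},x_{\sigma(3)})$, $\sigma\in S_3$ (the symmetric group on three letters).
   Context: A tuple $(f_1,f_2,f_3)$ of forms of the same degree in $k[x_1,x_2,x_3]$, not all zero, defines a rational map $\mathbb{P}^2\dashrightarrow\mathbb{P}^2$; the tuples $(f_1,f_2,f_3)$ and $(gf_1,gf_2,gf_3)$, with $g$ a non-zero form, define the same rational map and are identified. A Cremona map of $\mathbb{P}^2$ is such a rational map admitting an inverse rational map $\mathbb{P}^2\dashrightarrow\mathbb{P}^2$. A Cremona monomial map is a Cremona map defined by three monomials (with coefficient $1$) of the same degree. The plane Cremona monomial group is the subgroup of the Cremona group of $\mathbb{P}^2$ whose elements are the Cremona monomial maps (the inverse of a Cremona monomial map is again a Cremona monomial map). *)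

theory Defs
  imports "HOL-Algebra.Generated_Groups" "HOL-Library.Poly_Mapping" "HOL-Library.Numeral_Type"
begin

text \<open>
  \<open>k[x\<^sub>1, x\<^sub>2, x\<^sub>3]\<close> is the monoid algebra of the exponent vectors \<open>3 \<Rightarrow>\<^sub>0 nat\<close>. The index type \<open>3\<close>
  consists of the residues modulo 3, so that \<open>1\<close>, \<open>2\<close>, \<open>3 = 0\<close> are its three elements.
\<close>

type_synonym 'k mpoly3 = "(3 \<Rightarrow>\<^sub>0 nat) \<Rightarrow>\<^sub>0 'k"

type_synonym 'k tuple3 = "3 \<Rightarrow> 'k mpoly3"

definition monomial :: "(3 \<Rightarrow>\<^sub>0 nat) \<Rightarrow> 'k::field mpoly3" where
  "monomial m = Poly_Mapping.single m 1"

definition X :: "3 \<Rightarrow> 'k::field mpoly3" where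
  "X i = monomial (Poly_Mapping.single i 1)"

definition mdeg :: "(3 \<Rightarrow>\<^sub>0 nat) \<Rightarrow> nat" where
  "mdeg m = (\<Sum>i\<in>UNIV. Poly_Mapping.lookup m i)"

definition form :: "nat \<Rightarrow> 'k::field mpoly3 \<Rightarrow> bool" where
  "form d p \<longleftrightarrow> (\<forall>m\<in>Poly_Mapping.keys p. mdeg m = d)"

definition subst :: "'k::field tuple3 \<Rightarrow> 'k mpoly3 \<Rightarrow> 'k mpoly3" where
  "subst g p = (\<Sum>m\<in>Poly_Mapping.keys p.
     Poly_Mapping.single 0 (Poly_Mapping.lookup p m) * (\<Prod>i\<in>UNIV. g i ^ Poly_Mapping.lookup m i))"

definition triple :: "'a \<Rightarrow> 'a \<Rightarrow> 'a \<Rightarrow> 3 \<Rightarrow> 'a" where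
  "triple a b c = (\<lambda>i. if i = 1 then a else if i = 2 then b else c)"

definition form_tuples :: "'k::field tuple3 set" where
  "form_tuples = {f. (\<exists>d. \<forall>i. form d (f i)) \<and> (\<exists>i. f i \<noteq> 0)}"

text \<open>
  The equivalence relation generated by identifying \<open>(f\<^sub>1, f\<^sub>2, f\<^sub>3)\<close> with \<open>(g f\<^sub>1, g f\<^sub>2, g f\<^sub>3)\<close>
  for the non-zero forms \<open>g\<close>.
\<close>

definition ratmap_rel :: "('k::field tuple3 \<times> 'k tuple3) set" where
  "ratmap_rel = {(f, f'). f \<in> form_tuples \<and> f' \<in> form_tuples \<and>
     (\<exists>g h d e. form d g \<and> g \<noteq> 0 \<and> form e h \<and> h \<noteq> 0 \<and> (\<forall>i. g * f i = h * f' i))}"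

text \<open>
  A rational map \<open>\<P>\<^sup>2 \<dashrightarrow> \<P>\<^sup>2\<close> is an equivalence class of tuples. For tuples outside
  \<^const>\<open>form_tuples\<close>, \<open>ratmap\<close> yields the empty set, which is no rational map.
\<close>

definition ratmap :: "'k::field tuple3 \<Rightarrow> 'k tuple3 set" where
  "ratmap f = ratmap_rel `` {f}"

definition ratmaps :: "'k::field tuple3 set set" where
  "ratmaps = form_tuples // ratmap_rel"

definition tuple_comp :: "'k::field tuple3 \<Rightarrow> 'k tuple3 \<Rightarrow> 'k tuple3" where
  "tuple_comp f g = (\<lambda>i. subst g (f i))"

text \<open>
  \<open>F \<circ> G\<close>; it is the empty set if the composition is undefined, that is, if substituting \<open>G\<close>
  into \<open>F\<close> gives the zero tuple.
\<close>

definition ratmap_comp :: "'k::field tuple3 set \<Rightarrow> 'k tuple3 set \<Rightarrow> 'k tuple3 set" where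
  "ratmap_comp F G = (\<Union>f\<in>F. \<Union>g\<in>G. ratmap (tuple_comp f g))"

definition cremona_maps :: "'k::field tuple3 set set" where
  "cremona_maps = {F \<in> ratmaps. \<exists>G\<in>ratmaps. ratmap_comp F G = ratmap X \<and> ratmap_comp G F = ratmap X}"

definition cremona_group :: "'k::field tuple3 set monoid" where
  "cremona_group = \<lparr>carrier = cremona_maps, mult = ratmap_comp, one = ratmap X\<rparr>"

definition cremona_monomial_maps :: "'k::field tuple3 set set" where
  "cremona_monomial_maps = {F \<in> cremona_maps.
     \<exists>m d. (\<forall>i. mdeg (m i) = d) \<and> F = ratmap (\<lambda>i. monomial (m i))}"

definition map_S :: "'k::field tuple3 set" where
  "map_S = ratmap (triple (X 1 * X 2) (X 1 * X 3) (X 2 * X 3))"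

definition map_H :: "'k::field tuple3 set" where
  "map_H = ratmap (triple (X 1 ^ 2) (X 1 * X 2) (X 2 * X 3))"

definition permutation_maps :: "'k::field tuple3 set set" where
  "permutation_maps = {ratmap (\<lambda>i. X (\<sigma> i)) |\<sigma>. bij \<sigma>}"


subsection \<open>The Cremona maps form a group\<close>

lemma monomial_0: "monomial 0 = 1"
  by (simp add: monomial_def)

lemma monomial_add: "monomial (m + n) = monomial m * monomial n"
  by (simp add: monomial_def mult_single)

lemma subst_superset:
  assumes "finite A" "Poly_Mapping.keys p \<subseteq> A"
  shows "subst g p = (\<Sum>m\<in>A.
     Poly_Mapping.single 0 (Poly_Mapping.lookup p m) * (\<Prod>i\<in>UNIV. g i ^ Poly_Mapping.lookup m i))"
  unfolding subst_def
  by (rule sum.mono_neutral_left) (use assms in \<open>auto simp: in_keys_iff\<close>)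

lemma subst_0 [simp]: "subst g 0 = 0"
  by (simp add: subst_def)

lemma subst_add: "subst g (p + q) = subst g p + subst g q"
proof -
  let ?A = "Poly_Mapping.keys p \<union> Poly_Mapping.keys q"
  have "Poly_Mapping.keys (p + q) \<subseteq> ?A" by (rule keys_add)
  then show ?thesis
    by (simp add: subst_superset[where A = ?A] lookup_add single_add distrib_right sum.distrib)
qed

lemma subst_sum: "subst g (sum p A) = (\<Sum>a\<in>A. subst g (p a))"
  by (induction A rule: infinite_finite_induct) (auto simp: subst_add)

lemma subst_single:
  "subst g (Poly_Mapping.single m c) = Poly_Mapping.single 0 c * (\<Prod>i\<in>UNIV. g i ^ Poly_Mapping.lookup m i)"
  by (simp add: subst_superset[where A = "{m}"])

lemma mpoly3_decomp:
  "p = (\<Sum>m\<in>Poly_Mapping.keys p. Poly_Mapping.single m (Poly_Mapping.lookup p m))"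
  by (rule poly_mapping_eqI)
     (auto simp: lookup_sum lookup_single when_def in_keys_iff if_distrib sum.delta)

lemma mpoly3_induct [case_names add single]:
  assumes "\<And>p q. P p \<Longrightarrow> P q \<Longrightarrow> P (p + q)" "\<And>m c. P (Poly_Mapping.single m c)"
  shows "P (p :: 'k::field mpoly3)"
proof -
  have "P 0" using assms(2)[of 0 0] by simp
  then have "P (sum (\<lambda>m. Poly_Mapping.single m (c m)) A)" for c A
    by (induction A rule: infinite_finite_induct) (auto intro: assms)
  then show ?thesis by (subst mpoly3_decomp)
qed

lemma subst_mult: "subst g (p * q) = subst g p * subst g q"
proof (induction p rule: mpoly3_induct)
  case (add p p')
  then show ?case by (simp add: distrib_right subst_add)
next
  case (single m c)
  show ?case
  proof (induction q rule: mpoly3_induct)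
    case (add q q')
    then show ?case by (simp add: distrib_left subst_add)
  next
    case (single n d)
    have "Poly_Mapping.single 0 (c * d) = (Poly_Mapping.single 0 c * Poly_Mapping.single 0 d :: 'a mpoly3)"
      by (simp add: mult_single)
    then show ?case
      by (simp add: mult_single subst_single lookup_add power_add prod.distrib ac_simps)
  qed
qed

lemma subst_const [simp]: "subst g (Poly_Mapping.single 0 c) = Poly_Mapping.single 0 c"
  by (simp add: subst_single)

lemma subst_1 [simp]: "subst g 1 = 1"
  by (metis single_one subst_const)

lemma subst_power: "subst g (p ^ n) = subst g p ^ n"
  by (induction n) (auto simp: subst_mult)

lemma subst_prod: "subst g (prod p A) = (\<Prod>a\<in>A. subst g (p a))"
  by (induction A rule: infinite_finite_induct) (auto simp: subst_mult)

lemma subst_subst: "subst h (subst g p) = subst (\<lambda>i. subst h (g i)) p"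
  by (simp add: subst_def[of g p] subst_def[of "\<lambda>i. subst h (g i)" p]
      subst_sum subst_mult subst_prod subst_power)

lemma X_power: "X i ^ n = monomial (Poly_Mapping.single i n)"
proof (induction n)
  case (Suc n)
  have "Poly_Mapping.single i (Suc n) = Poly_Mapping.single i 1 + Poly_Mapping.single i n"
    by (simp flip: single_add)
  then show ?case by (simp only: power_Suc Suc) (simp only: X_def monomial_add)
qed (simp add: monomial_0)

lemma monomial_sum: "monomial (sum f A) = (\<Prod>a\<in>A. monomial (f a))"
  by (induction A rule: infinite_finite_induct) (auto simp: monomial_0 monomial_add)

lemma monomial_eq_prod: "monomial m = (\<Prod>i\<in>UNIV. X i ^ Poly_Mapping.lookup m i)"
proof -
  have "m = (\<Sum>i\<in>UNIV. Poly_Mapping.single i (Poly_Mapping.lookup m i))"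
    by (rule poly_mapping_eqI) (simp add: lookup_sum lookup_single when_def)
  then show ?thesis by (metis (no_types, lifting) X_power monomial_sum prod.cong)
qed

lemma subst_monomial: "subst g (monomial m) = (\<Prod>i\<in>UNIV. g i ^ Poly_Mapping.lookup m i)"
  by (simp add: monomial_def subst_single)

lemma subst_X [simp]: "subst g (X i) = g i"
proof -
  have "subst g (X i) = (\<Prod>j\<in>UNIV. if i = j then g j else 1)"
    unfolding X_def subst_monomial by (rule prod.cong) (auto simp: lookup_single when_def)
  then show ?thesis by simp
qed

lemma subst_X_left [simp]: "subst X p = p"
proof (induction p rule: mpoly3_induct)
  case (single m c)
  then show ?case
    by (simp add: subst_single mult_single monomial_def flip: monomial_eq_prod)
qed (simp add: subst_add)

lemma form_0 [simp]: "form d 0"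
  by (simp add: form_def)

lemma form_const [simp]: "form 0 (Poly_Mapping.single 0 c)"
  by (simp add: form_def mdeg_def)

lemma form_1 [simp]: "form 0 1"
  using form_const[of 1] by simp

lemma mdeg_add: "mdeg (m + n) = mdeg m + mdeg n"
  by (simp add: mdeg_def lookup_add sum.distrib)

lemma form_add: "form d p \<Longrightarrow> form d q \<Longrightarrow> form d (p + q)"
  using keys_add[of p q] by (auto simp: form_def)

lemma form_sum: "(\<And>a. a \<in> A \<Longrightarrow> form d (p a)) \<Longrightarrow> form d (sum p A)"
  by (induction A rule: infinite_finite_induct) (auto simp: form_add)

lemma form_mult: "form d p \<Longrightarrow> form e q \<Longrightarrow> form (d + e) (p * q)"
  using keys_mult[of p q] by (auto simp: form_def mdeg_add)

lemma form_power: "form d p \<Longrightarrow> form (d * n) (p ^ n)"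
  by (induction n) (auto simp: form_mult)

lemma form_prod: "(\<And>a. a \<in> A \<Longrightarrow> form (d a) (p a)) \<Longrightarrow> form (sum d A) (prod p A)"
  by (induction A rule: infinite_finite_induct) (auto simp: form_mult)

lemma form_monomial: "form d (monomial m) \<longleftrightarrow> mdeg m = d"
  by (simp add: form_def monomial_def)

lemma form_X [simp]: "form 1 (X i)"
  by (simp add: X_def form_monomial mdeg_def lookup_single when_def)

lemma monomial_nonzero [simp]: "monomial m \<noteq> 0"
  by (metis lookup_single_eq lookup_zero monomial_def zero_neq_one)

lemma X_nonzero [simp]: "X i \<noteq> 0"
  by (simp add: X_def)

lemma form_subst:
  assumes "\<And>i. form d (g i)" "form e p"
  shows "form (d * e) (subst g p)"
  unfolding subst_def
proof (rule form_sum)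
  fix m assume "m \<in> Poly_Mapping.keys p"
  then have m: "mdeg m = e" using assms(2) by (simp add: form_def)
  have "form (0 + (\<Sum>i\<in>UNIV. d * Poly_Mapping.lookup m i))
    (Poly_Mapping.single 0 (Poly_Mapping.lookup p m) * (\<Prod>i\<in>UNIV. g i ^ Poly_Mapping.lookup m i))"
    by (intro form_mult form_prod form_power form_const assms)
  moreover have "(\<Sum>i\<in>UNIV. d * Poly_Mapping.lookup m i) = d * e"
    using m by (simp add: mdeg_def flip: sum_distrib_left)
  ultimately show "form (d * e)
    (Poly_Mapping.single 0 (Poly_Mapping.lookup p m) * (\<Prod>i\<in>UNIV. g i ^ Poly_Mapping.lookup m i))"
    by simp
qed

lemma subst_scale:
  assumes "form e p"
  shows "subst (\<lambda>i. a * g i) p = a ^ e * subst g p"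
  unfolding subst_def sum_distrib_left
proof (rule sum.cong)
  fix m assume "m \<in> Poly_Mapping.keys p"
  then have "e = (\<Sum>i\<in>UNIV. Poly_Mapping.lookup m i)"
    using assms by (auto simp: form_def mdeg_def)
  then have "(\<Prod>i\<in>UNIV. (a * g i) ^ Poly_Mapping.lookup m i) =
      a ^ e * (\<Prod>i\<in>UNIV. g i ^ Poly_Mapping.lookup m i)"
    by (simp add: power_mult_distrib prod.distrib power_sum)
  then show "Poly_Mapping.single 0 (Poly_Mapping.lookup p m) *
      (\<Prod>i\<in>UNIV. (a * g i) ^ Poly_Mapping.lookup m i) =
    a ^ e * (Poly_Mapping.single 0 (Poly_Mapping.lookup p m) *
      (\<Prod>i\<in>UNIV. g i ^ Poly_Mapping.lookup m i))"
    by (simp add: ac_simps)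
qed simp

lemma ratmap_relE:
  assumes "(f, f') \<in> ratmap_rel"
  obtains a b where "a \<noteq> 0" "b \<noteq> 0" "\<And>i. a * f i = b * f' i"
  using assms unfolding ratmap_rel_def by auto

lemma ratmap_relI:
  assumes f: "f \<in> form_tuples" "f' \<in> form_tuples" and eq: "\<And>i j. f i * f' j = f j * f' i"
  shows "(f, f') \<in> ratmap_rel"
proof -
  obtain d d' where d: "\<And>i. form d (f i)" "\<And>i. form d' (f' i)"
    using f unfolding form_tuples_def by blast
  obtain j where j: "f j \<noteq> 0" using f unfolding form_tuples_def by blast
  obtain l where l: "f' l \<noteq> 0" using f unfolding form_tuples_def by blast
  have "f' j \<noteq> 0" using eq[of j l] j l by auto
  moreover have "\<forall>i. f' j * f i = f j * f' i" using eq by (simp add: mult.commute)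
  ultimately show ?thesis unfolding ratmap_rel_def using f j d by blast
qed

lemma ratmap_rel_prop:
  assumes "(f, f') \<in> ratmap_rel"
  shows "f i * f' j = f j * f' i"
proof -
  obtain a b where ab: "a \<noteq> 0" "b \<noteq> 0" "\<And>i. a * f i = b * f' i" using assms by (rule ratmap_relE) blast
  have "a * (f i * f' j) = (a * f i) * f' j" by (simp add: ac_simps)
  also have "\<dots> = (b * f' j) * f' i" by (simp add: ab ac_simps)
  also have "\<dots> = a * (f j * f' i)" by (simp add: ab(3)[symmetric] ac_simps)
  finally show ?thesis using ab(1) by simp
qed

lemma ratmap_rel_form_tuples:
  "(f, f') \<in> ratmap_rel \<Longrightarrow> f \<in> form_tuples" "(f, f') \<in> ratmap_rel \<Longrightarrow> f' \<in> form_tuples"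
  by (simp_all add: ratmap_rel_def)

lemma equiv_ratmap_rel: "equiv (form_tuples :: 'k::field tuple3 set) ratmap_rel"
proof (rule equivI)
  show "ratmap_rel \<subseteq> form_tuples \<times> form_tuples"
    by (auto simp: ratmap_rel_def)
  show "refl_on form_tuples ratmap_rel"
    by (auto intro!: refl_onI ratmap_relI simp: mult.commute)
  show "sym (ratmap_rel :: ('k tuple3 \<times> _) set)"
  proof (rule symI)
    fix f f' :: "'k tuple3"
    assume a: "(f, f') \<in> ratmap_rel"
    show "(f', f) \<in> ratmap_rel"
      by (rule ratmap_relI[OF ratmap_rel_form_tuples(2)[OF a] ratmap_rel_form_tuples(1)[OF a]])
         (metis a mult.commute ratmap_rel_prop)
  qed
  show "trans (ratmap_rel :: ('k tuple3 \<times> _) set)"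
  proof (rule transI)
    fix f f' f'' :: "'k tuple3"
    assume a: "(f, f') \<in> ratmap_rel" "(f', f'') \<in> ratmap_rel"
    obtain p q where p: "p \<noteq> 0" "q \<noteq> 0" "\<And>i. p * f i = q * f' i" using a(1) by (rule ratmap_relE) blast
    show "(f, f'') \<in> ratmap_rel"
    proof (rule ratmap_relI)
      show "f \<in> form_tuples" "f'' \<in> form_tuples"
        using a by (auto intro: ratmap_rel_form_tuples)
      fix i j
      have "p * (f i * f'' j) = q * (f' i * f'' j)" by (simp add: p mult.assoc[symmetric])
      also have "\<dots> = q * (f' j * f'' i)" using a(2) by (simp add: ratmap_rel_prop)
      also have "\<dots> = p * (f j * f'' i)" by (simp add: p mult.assoc[symmetric])
      finally show "f i * f'' j = f j * f'' i" using p(1) by simp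
    qed
  qed
qed

lemma ratmap_eq_iff:
  assumes "f \<in> form_tuples" "g \<in> form_tuples"
  shows "ratmap f = ratmap g \<longleftrightarrow> (f, g) \<in> ratmap_rel"
  unfolding ratmap_def using assms equiv_ratmap_rel eq_equiv_class_iff by fastforce

lemma ratmap_in_ratmaps: "f \<in> form_tuples \<Longrightarrow> ratmap f \<in> ratmaps"
  by (simp add: ratmap_def ratmaps_def quotientI)

lemma ratmapsE:
  assumes "F \<in> ratmaps"
  obtains f where "f \<in> form_tuples" "F = ratmap f"
  using assms by (auto simp: ratmap_def ratmaps_def elim: quotientE)

lemma mem_ratmap: "f \<in> form_tuples \<Longrightarrow> f \<in> ratmap f"
  by (metis equiv_ratmap_rel equiv_class_self ratmap_def)

lemma ratmap_not_form_tuples: "f \<notin> form_tuples \<Longrightarrow> ratmap f = {}"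
  by (auto simp: ratmap_def ratmap_rel_def)

lemma X_form_tuples [simp]: "X \<in> form_tuples"
  unfolding form_tuples_def using form_X X_nonzero by blast

lemma ratmap_comp_eq:
  assumes "f \<in> form_tuples" "g \<in> form_tuples" and fg: "tuple_comp f g \<in> form_tuples"
  shows "ratmap_comp (ratmap f) (ratmap g) = ratmap (tuple_comp f g)"
proof -
  have *: "ratmap (tuple_comp f' g') = ratmap (tuple_comp f g)"
    if ff': "(f, f') \<in> ratmap_rel" and gg': "(g, g') \<in> ratmap_rel"
      and fg': "tuple_comp f' g' \<in> form_tuples" for f' g'
  proof -
    obtain a b where ab: "a \<noteq> 0" "b \<noteq> 0" "\<And>i. a * g i = b * g' i" using gg' by (rule ratmap_relE) blast
    obtain d where d: "\<And>i. form d (f i)" using assms(1) unfolding form_tuples_def by blast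
    have g: "a ^ d * tuple_comp f g i = b ^ d * subst g' (f i)" for i
      unfolding tuple_comp_def using subst_scale[OF d, of a g] subst_scale[OF d, of b g']
      by (simp add: ab(3))
    have f: "subst g' (f i) * tuple_comp f' g' j = subst g' (f j) * tuple_comp f' g' i" for i j
      unfolding tuple_comp_def by (simp add: ratmap_rel_prop[OF ff'] flip: subst_mult)
    have "(tuple_comp f g, tuple_comp f' g') \<in> ratmap_rel"
    proof (rule ratmap_relI[OF fg fg'])
      fix i j
      have "a ^ d * (tuple_comp f g i * tuple_comp f' g' j)
          = b ^ d * (subst g' (f i) * tuple_comp f' g' j)"
        by (simp add: g mult.assoc[symmetric])
      also have "\<dots> = b ^ d * (subst g' (f j) * tuple_comp f' g' i)"
        by (simp only: f)
      also have "\<dots> = a ^ d * (tuple_comp f g j * tuple_comp f' g' i)"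
        by (simp add: g mult.assoc[symmetric])
      finally show "tuple_comp f g i * tuple_comp f' g' j = tuple_comp f g j * tuple_comp f' g' i"
        using ab(1) by simp
    qed
    then show ?thesis using fg fg' using ratmap_eq_iff by blast
  qed
  have "ratmap (tuple_comp f' g') \<subseteq> ratmap (tuple_comp f g)"
    if "f' \<in> ratmap f" "g' \<in> ratmap g" for f' g'
    using that *[of f' g'] ratmap_not_form_tuples[of "tuple_comp f' g'"]
    unfolding ratmap_def by auto
  then show ?thesis
    unfolding ratmap_comp_def using mem_ratmap[OF assms(1)] mem_ratmap[OF assms(2)] by blast
qed

text \<open>The tuples at which no non-zero form vanishes; they can be composed without restriction.\<close>

definition dominant :: "'k::field tuple3 \<Rightarrow> bool" where
  "dominant g \<longleftrightarrow> g \<in> form_tuples \<and> (\<forall>e p. form e p \<longrightarrow> subst g p = 0 \<longrightarrow> p = 0)"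

lemma dominant_X: "dominant X"
  by (simp add: dominant_def)

lemma dominant_form_tuples: "dominant f \<Longrightarrow> f \<in> form_tuples"
  by (simp add: dominant_def)

lemma dominantD: "dominant g \<Longrightarrow> form e p \<Longrightarrow> subst g p = 0 \<Longrightarrow> p = 0"
  by (auto simp: dominant_def)

lemma dominant_cong:
  assumes "(f, g) \<in> ratmap_rel" "dominant f"
  shows "dominant g"
  unfolding dominant_def
proof (intro conjI allI impI)
  show "g \<in> form_tuples" using assms(1) by (rule ratmap_rel_form_tuples)
  obtain a b where ab: "a \<noteq> 0" "b \<noteq> 0" "\<And>i. a * f i = b * g i" using assms(1) by (rule ratmap_relE) blast
  fix e p assume p: "form e p" "subst g p = 0"
  have "a ^ e * subst f p = b ^ e * subst g p"
    using subst_scale[OF p(1), of a f] subst_scale[OF p(1), of b g] by (simp add: ab(3))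
  then have "subst f p = 0" using p ab by simp
  then show "p = 0" using assms(2) p(1) dominantD by blast
qed

lemma dominant_left:
  assumes "dominant (tuple_comp f g)" "f \<in> form_tuples"
  shows "dominant f"
proof -
  have "p = 0" if "form e p" "subst f p = 0" for e p
  proof -
    have "subst (tuple_comp f g) p = subst g (subst f p)"
      by (simp add: tuple_comp_def subst_subst)
    then show ?thesis using that assms(1) dominantD by fastforce
  qed
  then show ?thesis using assms(2) by (auto simp: dominant_def)
qed

lemma dominant_comp:
  assumes f: "dominant f" and g: "dominant g"
  shows "dominant (tuple_comp f g)"
proof -
  obtain d where d: "\<And>i. form d (f i)"
    using f unfolding dominant_def form_tuples_def by blast
  obtain e where e: "\<And>i. form e (g i)"
    using g unfolding dominant_def form_tuples_def by blast
  obtain i where i: "f i \<noteq> 0" using f unfolding dominant_def form_tuples_def by blast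
  have "tuple_comp f g i \<noteq> 0" using dominantD[OF g d[of i]] i by (auto simp: tuple_comp_def)
  moreover have "form (e * d) (tuple_comp f g i)" for i
    unfolding tuple_comp_def by (rule form_subst[OF e d])
  ultimately have "tuple_comp f g \<in> form_tuples"
    unfolding form_tuples_def by blast
  moreover have "p = 0" if p: "form n p" "subst (tuple_comp f g) p = 0" for n p
  proof -
    have "subst g (subst f p) = 0" using p(2) by (simp add: tuple_comp_def subst_subst)
    then have "subst f p = 0" using dominantD[OF g form_subst[of d f, OF d p(1)]] by blast
    then show ?thesis using dominantD[OF f p(1)] by blast
  qed
  ultimately show ?thesis by (auto simp: dominant_def)
qed

lemma ratmap_comp_dominant:
  assumes "dominant f" "dominant g"
  shows "ratmap_comp (ratmap f) (ratmap g) = ratmap (tuple_comp f g)"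
  using assms by (intro ratmap_comp_eq dominant_form_tuples dominant_comp)

lemma ratmap_comp_X_dominant:
  assumes F: "F \<in> ratmaps" and G: "G \<in> ratmaps" and FG: "ratmap_comp F G = ratmap X"
  obtains f where "dominant f" "F = ratmap f"
proof -
  have "X \<in> ratmap_comp F G" using FG mem_ratmap[OF X_form_tuples] by simp
  then obtain f g where fg: "f \<in> F" "g \<in> G" "X \<in> ratmap (tuple_comp f g)"
    unfolding ratmap_comp_def by blast
  then have "(X, tuple_comp f g) \<in> ratmap_rel"
    using equiv_ratmap_rel unfolding ratmap_def by (auto elim: equivE dest: symD)
  then have dom: "dominant (tuple_comp f g)" using dominant_X dominant_cong by blast
  obtain f0 where f0: "f0 \<in> form_tuples" "F = ratmap f0" using F by (rule ratmapsE)
  then have rel: "(f0, f) \<in> ratmap_rel" using fg(1) by (simp add: ratmap_def)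
  then have f: "f \<in> form_tuples" by (rule ratmap_rel_form_tuples)
  have "dominant f" by (rule dominant_left[OF dom f])
  moreover have "F = ratmap f" using f0 f rel ratmap_eq_iff by blast
  ultimately show thesis by (rule that)
qed

lemma tuple_comp_assoc: "tuple_comp (tuple_comp f g) h = tuple_comp f (tuple_comp g h)"
  by (simp add: tuple_comp_def subst_subst)

lemma tuple_comp_X: "tuple_comp X g = g" "tuple_comp g X = g"
  by (simp_all add: tuple_comp_def)

lemma cremona_mapsE:
  assumes "F \<in> cremona_maps"
  obtains f g where "dominant f" "F = ratmap f" "dominant g"
    "ratmap (tuple_comp f g) = ratmap X" "ratmap (tuple_comp g f) = ratmap X"
proof -
  obtain G where G: "F \<in> ratmaps" "G \<in> ratmaps" "ratmap_comp F G = ratmap X" "ratmap_comp G F = ratmap X"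
    using assms by (auto simp: cremona_maps_def)
  obtain f where f: "dominant f" "F = ratmap f" using G(1,2,3) by (rule ratmap_comp_X_dominant)
  obtain g where g: "dominant g" "G = ratmap g" using G(2,1,4) by (rule ratmap_comp_X_dominant)
  show thesis by (rule that[OF f g(1)]) (use G f g in \<open>simp_all add: ratmap_comp_dominant\<close>)
qed

lemma cremona_mapsI:
  assumes "dominant f" "dominant g" "ratmap (tuple_comp f g) = ratmap X" "ratmap (tuple_comp g f) = ratmap X"
  shows "ratmap f \<in> cremona_maps"
  unfolding cremona_maps_def using assms
  by (auto simp: ratmap_comp_dominant ratmap_in_ratmaps dominant_form_tuples intro!: bexI[of _ "ratmap g"])

theorem group_cremona_group: "group (cremona_group :: 'k::field tuple3 set monoid)"
proof (rule groupI)
  fix F G :: "'k tuple3 set"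
  assume "F \<in> carrier cremona_group" "G \<in> carrier cremona_group"
  then have FG: "F \<in> cremona_maps" "G \<in> cremona_maps" by (simp_all add: cremona_group_def)
  obtain f f' where f: "dominant f" "F = ratmap f" "dominant f'"
    "ratmap (tuple_comp f f') = ratmap X" "ratmap (tuple_comp f' f) = ratmap X"
    using FG(1) by (rule cremona_mapsE)
  obtain g g' where g: "dominant g" "G = ratmap g" "dominant g'"
    "ratmap (tuple_comp g g') = ratmap X" "ratmap (tuple_comp g' g) = ratmap X"
    using FG(2) by (rule cremona_mapsE)
  have cancel: "ratmap (tuple_comp (tuple_comp p q) (tuple_comp q' p')) = ratmap X"
    if "dominant p" "dominant q" "dominant p'" "dominant q'"
      "ratmap (tuple_comp q q') = ratmap X" "ratmap (tuple_comp p p') = ratmap X"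
    for p q p' q' :: "'k tuple3"
  proof -
    have "ratmap (tuple_comp (tuple_comp p q) (tuple_comp q' p'))
        = ratmap (tuple_comp p (tuple_comp (tuple_comp q q') p'))"
      by (simp add: tuple_comp_assoc)
    also have "\<dots> = ratmap_comp (ratmap p) (ratmap_comp (ratmap (tuple_comp q q')) (ratmap p'))"
      using that(1-4) by (simp add: ratmap_comp_dominant dominant_comp)
    also have "\<dots> = ratmap X"
      using that by (simp add: ratmap_comp_dominant dominant_comp dominant_X tuple_comp_X)
    finally show ?thesis .
  qed
  have "ratmap (tuple_comp f g) \<in> cremona_maps"
    by (rule cremona_mapsI[of _ "tuple_comp g' f'"]) (use f g in \<open>simp_all add: dominant_comp cancel\<close>)
  then show "F \<otimes>\<^bsub>cremona_group\<^esub> G \<in> carrier cremona_group"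
    using f g by (simp add: cremona_group_def ratmap_comp_dominant)
next
  show "\<one>\<^bsub>cremona_group\<^esub> \<in> carrier (cremona_group :: 'k tuple3 set monoid)"
    using cremona_mapsI[OF dominant_X dominant_X] by (simp add: cremona_group_def tuple_comp_X)
next
  fix F G H :: "'k tuple3 set"
  assume "F \<in> carrier cremona_group" "G \<in> carrier cremona_group" "H \<in> carrier cremona_group"
  then obtain f g h where "dominant f" "F = ratmap f" "dominant g" "G = ratmap g" "dominant h" "H = ratmap h"
    by (auto simp: cremona_group_def elim!: cremona_mapsE)
  then show "F \<otimes>\<^bsub>cremona_group\<^esub> G \<otimes>\<^bsub>cremona_group\<^esub> H = F \<otimes>\<^bsub>cremona_group\<^esub> (G \<otimes>\<^bsub>cremona_group\<^esub> H)"
    by (simp add: cremona_group_def ratmap_comp_dominant dominant_comp tuple_comp_assoc)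
next
  fix F :: "'k tuple3 set"
  assume "F \<in> carrier cremona_group"
  then have F: "F \<in> cremona_maps" by (simp add: cremona_group_def)
  obtain f g where f: "dominant f" "F = ratmap f" "dominant g"
    "ratmap (tuple_comp f g) = ratmap X" "ratmap (tuple_comp g f) = ratmap X"
    using F by (rule cremona_mapsE)
  show "\<one>\<^bsub>cremona_group\<^esub> \<otimes>\<^bsub>cremona_group\<^esub> F = F"
    using f by (simp add: cremona_group_def ratmap_comp_dominant dominant_X tuple_comp_X)
  have "ratmap g \<in> cremona_maps" by (rule cremona_mapsI[of _ f]) (use f in simp_all)
  then show "\<exists>G\<in>carrier cremona_group. G \<otimes>\<^bsub>cremona_group\<^esub> F = \<one>\<^bsub>cremona_group\<^esub>"
    using f by (auto simp: cremona_group_def ratmap_comp_dominant intro!: bexI[of _ "ratmap g"])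
qed

end

theory Submission
  imports Defs
begin

text \<open>
  In the affine coordinates \<open>x\<^sub>2 / x\<^sub>1\<close>, \<open>x\<^sub>3 / x\<^sub>1\<close> a monomial rational map is determined by a
  \<open>2 \<times> 2\<close> integer matrix, and composition is the matrix product. The map is a Cremona map iff the
  determinant is \<open>\<plusminus>1\<close>, so the Cremona monomial maps form a copy of \<open>GL\<^sub>2(\<int>)\<close>. There \<open>H\<close> is an
  elementary matrix, exchanging \<open>x\<^sub>2\<close> and \<open>x\<^sub>3\<close> is the exchange of the rows, and exchanging \<open>x\<^sub>1\<close> and
  \<open>x\<^sub>2\<close> followed by \<open>H\<^sup>-\<^sup>1\<close> is the sign change of the first row. By the Euclidean algorithm these
  already generate \<open>GL\<^sub>2(\<int>)\<close>, without using \<open>S\<close>.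
\<close>

section \<open>Monomial tuples and the composition of their exponents\<close>

lemma UNIV_3: "(UNIV :: 3 set) = {1, 2, 3}"
proof -
  have "card {1, 2, 3 :: 3} = 3" by simp
  then show ?thesis by (intro card_subset_eq[symmetric]) simp_all
qed

lemma forall_3: "(\<forall>i::3. P i) \<longleftrightarrow> P 1 \<and> P 2 \<and> P 3"
  unfolding ball_UNIV[symmetric] UNIV_3 by simp

lemma sum_3: "(\<Sum>i\<in>(UNIV :: 3 set). f i) = f 1 + f 2 + f 3"
  unfolding UNIV_3 by (simp add: add.assoc)

lemma mdeg_3: "mdeg m = Poly_Mapping.lookup m 1 + Poly_Mapping.lookup m 2 + Poly_Mapping.lookup m 3"
  by (simp add: mdeg_def sum_3)

lemma monomial_power: "monomial m ^ k = monomial (\<Sum>_<k. m)"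
  by (simp only: monomial_sum prod_constant card_lessThan)

abbreviation monomial_tuple :: "(3 \<Rightarrow> 3 \<Rightarrow>\<^sub>0 nat) \<Rightarrow> 'k::field tuple3" where
  "monomial_tuple m \<equiv> \<lambda>i. monomial (m i)"

definition homogeneous :: "(3 \<Rightarrow> 3 \<Rightarrow>\<^sub>0 nat) \<Rightarrow> bool" where
  "homogeneous m \<longleftrightarrow> (\<exists>d. \<forall>i. mdeg (m i) = d)"

lemma homogeneous_3: "homogeneous m \<longleftrightarrow> mdeg (m 2) = mdeg (m 1) \<and> mdeg (m 3) = mdeg (m 1)"
  unfolding homogeneous_def forall_3 by auto

lemma monomial_form_tuples:
  assumes "homogeneous m"
  shows "monomial_tuple m \<in> form_tuples"
  using assms by (auto simp: form_tuples_def form_monomial homogeneous_def)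

text \<open>This is the product of the exponent matrices. Multiples of \<open>n j\<close> are
  written as iterated sums so that \<open>monomial_power\<close> applies.\<close>

definition comp_exponents :: "(3 \<Rightarrow> 3 \<Rightarrow>\<^sub>0 nat) \<Rightarrow> (3 \<Rightarrow> 3 \<Rightarrow>\<^sub>0 nat) \<Rightarrow> 3 \<Rightarrow> 3 \<Rightarrow>\<^sub>0 nat" where
  "comp_exponents m n i = (\<Sum>j\<in>UNIV. \<Sum>_<Poly_Mapping.lookup (m i) j. n j)"

lemma lookup_comp_exponents:
  "Poly_Mapping.lookup (comp_exponents m n i) k =
    (\<Sum>j\<in>UNIV. Poly_Mapping.lookup (m i) j * Poly_Mapping.lookup (n j) k)"
  by (simp add: comp_exponents_def lookup_sum del: sum_constant) simp

lemma subst_monomial_tuple: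
  "subst (monomial_tuple n) (monomial (m i)) = monomial (comp_exponents m n i)"
  by (simp only: subst_monomial monomial_power comp_exponents_def monomial_sum[of _ UNIV])

lemma tuple_comp_monomial:
  "tuple_comp (monomial_tuple m) (monomial_tuple n) = monomial_tuple (comp_exponents m n)"
  by (simp add: tuple_comp_def subst_monomial_tuple)

section \<open>Integer matrices of monomial maps\<close>

text \<open>
  With \<open>y = x\<^sub>2 / x\<^sub>1\<close> and \<open>z = x\<^sub>3 / x\<^sub>1\<close>, the map is \<open>(y, z) \<mapsto> (y^p z^q, y^r z^s)\<close>.
\<close>

definition has_matrix :: "(3 \<Rightarrow> 3 \<Rightarrow>\<^sub>0 nat) \<Rightarrow> int \<Rightarrow> int \<Rightarrow> int \<Rightarrow> int \<Rightarrow> bool" where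
  "has_matrix m p q r s \<longleftrightarrow> homogeneous m \<and>
     int (Poly_Mapping.lookup (m 2) 2) = int (Poly_Mapping.lookup (m 1) 2) + p \<and>
     int (Poly_Mapping.lookup (m 2) 3) = int (Poly_Mapping.lookup (m 1) 3) + q \<and>
     int (Poly_Mapping.lookup (m 3) 2) = int (Poly_Mapping.lookup (m 1) 2) + r \<and>
     int (Poly_Mapping.lookup (m 3) 3) = int (Poly_Mapping.lookup (m 1) 3) + s"

text \<open>Equal degrees determine the differences in the x_1 column from those in the other
  two.\<close>

lemma has_matrix_lookup_1:
  assumes "has_matrix m p q r s"
  shows "int (Poly_Mapping.lookup (m 2) 1) = int (Poly_Mapping.lookup (m 1) 1) - p - q"
    "int (Poly_Mapping.lookup (m 3) 1) = int (Poly_Mapping.lookup (m 1) 1) - r - s"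
  using assms unfolding has_matrix_def homogeneous_3 mdeg_3 by linarith+

lemma has_matrix_exists:
  assumes "homogeneous m"
  obtains p q r s where "has_matrix m p q r s"
proof
  let ?l = "\<lambda>i k. int (Poly_Mapping.lookup (m i) k)"
  show "has_matrix m (?l 2 2 - ?l 1 2) (?l 2 3 - ?l 1 3) (?l 3 2 - ?l 1 2) (?l 3 3 - ?l 1 3)"
    using assms by (simp add: has_matrix_def)
qed

text \<open>With a common matrix, \<open>m\<close> and \<open>n\<close> differ by an integral shift
  of exponents that is the same in every row, so the cross products required by
  \<open>ratmap_relI\<close> agree.\<close>

lemma has_matrix_unique:
  assumes m: "has_matrix m p q r s" and n: "has_matrix n p q r s"
  shows "ratmap (monomial_tuple m :: 'k::field tuple3) = ratmap (monomial_tuple n)"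
proof -
  have *: "\<forall>i k. int (Poly_Mapping.lookup (m i) k) - int (Poly_Mapping.lookup (m 1) k)
      = int (Poly_Mapping.lookup (n i) k) - int (Poly_Mapping.lookup (n 1) k)"
    unfolding forall_3 using m n has_matrix_lookup_1[OF m] has_matrix_lookup_1[OF n]
    by (simp add: has_matrix_def)
  have eq: "m i + n j = m j + n i" for i j
  proof (rule poly_mapping_eqI)
    fix k
    show "Poly_Mapping.lookup (m i + n j) k = Poly_Mapping.lookup (m j + n i) k"
      using *[rule_format, of i k] *[rule_format, of j k] by (simp add: lookup_add)
  qed
  have form: "monomial_tuple m \<in> form_tuples" "monomial_tuple n \<in> form_tuples"
    using m n by (auto simp: has_matrix_def intro: monomial_form_tuples)
  have "(monomial_tuple m :: 'k tuple3, monomial_tuple n) \<in> ratmap_rel"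
    by (rule ratmap_relI[OF form]) (simp add: eq flip: monomial_add)
  then show ?thesis using ratmap_eq_iff[OF form] by blast
qed

text \<open>Subtract the first row of the product of the exponent matrices. Eliminating the x_1
  column of \<open>m\<close> by homogeneity leaves combinations of the row differences of
  \<open>n\<close>.\<close>

lemma has_matrix_comp:
  assumes m: "has_matrix m p q r s" and n: "has_matrix n p' q' r' s'"
  shows "has_matrix (comp_exponents m n)
    (p * p' + q * r') (p * q' + q * s') (r * p' + s * r') (r * q' + s * s')"
proof -
  obtain d e where d: "\<And>i. mdeg (m i) = d" and e: "\<And>i. mdeg (n i) = e"
    using m n by (auto simp: has_matrix_def homogeneous_def)
  have "mdeg (comp_exponents m n i) = d * e" for i
  proof -
    have "mdeg (comp_exponents m n i) = (\<Sum>j\<in>UNIV. Poly_Mapping.lookup (m i) j * mdeg (n j))"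
      unfolding mdeg_def lookup_comp_exponents sum_distrib_left by (rule sum.swap)
    also have "\<dots> = mdeg (m i) * e"
      by (simp add: e) (simp add: mdeg_def sum_distrib_right)
    finally show ?thesis by (simp add: d)
  qed
  then have "homogeneous (comp_exponents m n)"
    by (simp add: homogeneous_def)
  then show ?thesis
    using m n unfolding has_matrix_def lookup_comp_exponents sum_3
    by (simp add: has_matrix_lookup_1[OF m]) (simp add: algebra_simps)
qed

text \<open>
  The exponents \<open>(0, 0, 0)\<close>, \<open>(-p - q, p, q)\<close>, \<open>(-r - s, r, s)\<close> are shifted by a common
  amount that makes all of them nonnegative, so that \<open>nat\<close> never truncates.
\<close>

definition matrix_exponents :: "int \<Rightarrow> int \<Rightarrow> int \<Rightarrow> int \<Rightarrow> 3 \<Rightarrow> 3 \<Rightarrow>\<^sub>0 nat" where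
  "matrix_exponents p q r s = triple
     (Abs_poly_mapping (\<lambda>_. nat (\<bar>p\<bar> + \<bar>q\<bar> + \<bar>r\<bar> + \<bar>s\<bar>)))
     (Abs_poly_mapping (\<lambda>k. nat (\<bar>p\<bar> + \<bar>q\<bar> + \<bar>r\<bar> + \<bar>s\<bar> + triple (- p - q) p q k)))
     (Abs_poly_mapping (\<lambda>k. nat (\<bar>p\<bar> + \<bar>q\<bar> + \<bar>r\<bar> + \<bar>s\<bar> + triple (- r - s) r s k)))"

lemma has_matrix_matrix_exponents: "has_matrix (matrix_exponents p q r s) p q r s"
proof -
  define K where "K = \<bar>p\<bar> + \<bar>q\<bar> + \<bar>r\<bar> + \<bar>s\<bar>"
  have "0 \<le> K" "0 \<le> K + p" "0 \<le> K + q" "0 \<le> K + r" "0 \<le> K + s"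
    "0 \<le> K + (- p - q)" "0 \<le> K + (- r - s)"
    unfolding K_def by linarith+
  then show ?thesis
    unfolding has_matrix_def homogeneous_3 mdeg_3 matrix_exponents_def K_def[symmetric]
    by (simp add: triple_def flip: of_nat_eq_iff[where 'a = int])
qed

definition matrix_map :: "int \<Rightarrow> int \<Rightarrow> int \<Rightarrow> int \<Rightarrow> 'k::field tuple3 set" where
  "matrix_map p q r s = ratmap (monomial_tuple (matrix_exponents p q r s))"

lemma ratmap_monomial_tuple:
  "has_matrix m p q r s \<Longrightarrow> ratmap (monomial_tuple m) = matrix_map p q r s"
  unfolding matrix_map_def by (rule has_matrix_unique[OF _ has_matrix_matrix_exponents])

text \<open>Monomials substituted into monomials never vanish, so the composition is defined for
  every matrix, even a singular one.\<close>

lemma matrix_map_comp: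
  "ratmap_comp (matrix_map p q r s) (matrix_map p' q' r' s') = (matrix_map
    (p * p' + q * r') (p * q' + q * s') (r * p' + s * r') (r * q' + s * s') :: 'k::field tuple3 set)"
proof -
  let ?m = "matrix_exponents p q r s" and ?n = "matrix_exponents p' q' r' s'"
  note mat = has_matrix_comp[OF has_matrix_matrix_exponents[of p q r s]
      has_matrix_matrix_exponents[of p' q' r' s']]
  have "monomial_tuple ?m \<in> form_tuples" "monomial_tuple ?n \<in> form_tuples"
    "monomial_tuple (comp_exponents ?m ?n) \<in> form_tuples"
    using mat has_matrix_matrix_exponents by (auto intro!: monomial_form_tuples simp: has_matrix_def)
  then have "ratmap_comp (matrix_map p q r s) (matrix_map p' q' r' s')
      = (ratmap (monomial_tuple (comp_exponents ?m ?n)) :: 'k tuple3 set)"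
    unfolding matrix_map_def by (subst ratmap_comp_eq) (auto simp: tuple_comp_monomial)
  then show ?thesis using ratmap_monomial_tuple[OF mat] by simp
qed

lemma X_conv_monomial: "X = monomial_tuple (\<lambda>i. Poly_Mapping.single i 1)"
  by (simp add: X_def fun_eq_iff)

lemma matrix_map_1: "matrix_map 1 0 0 1 = ratmap X"
  unfolding X_conv_monomial
  by (rule ratmap_monomial_tuple[symmetric])
     (simp add: has_matrix_def homogeneous_3 mdeg_3 lookup_single)

lemma matrix_map_in_ratmaps: "matrix_map p q r s \<in> ratmaps"
  unfolding matrix_map_def using has_matrix_matrix_exponents
  by (auto intro!: ratmap_in_ratmaps monomial_form_tuples simp: has_matrix_def)

text \<open>The inverse is \<open>e\<close> times the adjugate, since
  \<open>e * e = 1\<close>.\<close>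

lemma matrix_map_inverse:
  assumes "\<bar>p * s - q * r\<bar> = 1"
  defines "e \<equiv> p * s - q * r"
  shows "ratmap_comp (matrix_map p q r s) (matrix_map (e * s) (- e * q) (- e * r) (e * p)) = ratmap X"
    "ratmap_comp (matrix_map (e * s) (- e * q) (- e * r) (e * p)) (matrix_map p q r s) = ratmap X"
proof -
  have "\<bar>e\<bar> = 1" using assms by simp
  then have e: "e * e = 1" by (metis abs_mult_self_eq mult_1)
  have *: "p * (e * s) + q * (- e * r) = e * e" "r * (- e * q) + s * (e * p) = e * e"
    "p * (- e * q) + q * (e * p) = 0" "r * (e * s) + s * (- e * r) = 0"
    "e * s * p + - e * q * r = e * e" "- e * r * q + e * p * s = e * e"
    "e * s * q + - e * q * s = 0" "- e * r * p + e * p * r = 0"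
    by (simp_all add: e_def algebra_simps)
  show "ratmap_comp (matrix_map p q r s) (matrix_map (e * s) (- e * q) (- e * r) (e * p)) = ratmap X"
    "ratmap_comp (matrix_map (e * s) (- e * q) (- e * r) (e * p)) (matrix_map p q r s) = ratmap X"
    unfolding matrix_map_comp * e matrix_map_1 by (rule refl)+
qed

lemma matrix_map_cremona:
  "\<bar>p * s - q * r\<bar> = 1 \<Longrightarrow> matrix_map p q r s \<in> cremona_maps"
  unfolding cremona_maps_def
  using matrix_map_inverse[of p s q r] matrix_map_in_ratmaps by blast

section \<open>The determinant of a Cremona monomial map\<close>

text \<open>Each term is sent to a multiple of one monomial; terms may cancel, hence only an
  inclusion. The constant family and the index \<open>0\<close> merely apply
  \<open>comp_exponents\<close> to a single vector.\<close>

lemma keys_subst_monomial_tuple: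
  "Poly_Mapping.keys (subst (monomial_tuple m) p) \<subseteq>
    (\<lambda>n. comp_exponents (\<lambda>_. n) m 0) ` Poly_Mapping.keys p"
proof -
  have "Poly_Mapping.keys (subst (monomial_tuple m) p) \<subseteq>
    (\<Union>n\<in>Poly_Mapping.keys p. Poly_Mapping.keys
      (Poly_Mapping.single 0 (Poly_Mapping.lookup p n) * (\<Prod>i\<in>UNIV. monomial (m i) ^ Poly_Mapping.lookup n i)))"
    unfolding subst_def by (rule keys_sum)
  also have "\<dots> \<subseteq> (\<lambda>n. comp_exponents (\<lambda>_. n) m 0) ` Poly_Mapping.keys p"
  proof (rule UN_least)
    fix n assume n: "n \<in> Poly_Mapping.keys p"
    have "(\<Prod>i\<in>UNIV. monomial (m i) ^ Poly_Mapping.lookup n i)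
        = (monomial (comp_exponents (\<lambda>_. n) m 0) :: 'a mpoly3)"
      using subst_monomial_tuple[of m "\<lambda>_. n" 0] by (simp add: subst_monomial)
    then show "Poly_Mapping.keys (Poly_Mapping.single 0 (Poly_Mapping.lookup p n)
        * (\<Prod>i\<in>UNIV. monomial (m i) ^ Poly_Mapping.lookup n i))
      \<subseteq> (\<lambda>n. comp_exponents (\<lambda>_. n) m 0) ` Poly_Mapping.keys p"
      using n by (auto simp: monomial_def mult_single split: if_splits)
  qed
  finally show ?thesis .
qed

text \<open>\<open>u\<close> and \<open>v\<close> are images of exponents \<open>x\<close> and
  \<open>y\<close> of the same degree \<open>d\<close>. The difference of \<open>x\<close> and
  \<open>y\<close> has coordinate sum 0, so its image is a combination of the row differences of
  \<open>m\<close>, with its second and third coordinates as coefficients.\<close>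

lemma form_subst_lattice:
  assumes m: "has_matrix m p q r s" and p: "form d f" "form d g"
    and u: "u \<in> Poly_Mapping.keys (subst (monomial_tuple m) f)"
    and v: "v \<in> Poly_Mapping.keys (subst (monomial_tuple m) g)"
  obtains a b where
    "int (Poly_Mapping.lookup u 2) - int (Poly_Mapping.lookup v 2) = a * p + b * r"
    "int (Poly_Mapping.lookup u 3) - int (Poly_Mapping.lookup v 3) = a * q + b * s"
proof -
  obtain x y where xy: "u = comp_exponents (\<lambda>_. x) m 0" "v = comp_exponents (\<lambda>_. y) m 0"
    and "x \<in> Poly_Mapping.keys f" "y \<in> Poly_Mapping.keys g"
    using subsetD[OF keys_subst_monomial_tuple u] subsetD[OF keys_subst_monomial_tuple v]
    by (auto elim!: imageE)
  then have "mdeg x = d" "mdeg y = d" using p by (auto simp: form_def)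
  then have x1: "int (Poly_Mapping.lookup x 1) = int (Poly_Mapping.lookup y 1)
      + int (Poly_Mapping.lookup y 2) + int (Poly_Mapping.lookup y 3)
      - int (Poly_Mapping.lookup x 2) - int (Poly_Mapping.lookup x 3)"
    by (simp add: mdeg_3)
  show ?thesis
    by (intro that[of "int (Poly_Mapping.lookup x 2) - int (Poly_Mapping.lookup y 2)"
          "int (Poly_Mapping.lookup x 3) - int (Poly_Mapping.lookup y 3)"])
       (use m in \<open>simp_all add: xy lookup_comp_exponents sum_3 has_matrix_def x1,
         simp_all add: algebra_simps\<close>)
qed

text \<open>
  If \<open>g\<close> inverts the monomial map \<open>m\<close>, then \<open>g\<^sub>i(m) x\<^sub>j = g\<^sub>j(m) x\<^sub>i\<close>. Since all exponents of
  the \<open>g\<^sub>i(m)\<close> lie in one coset of the lattice spanned by \<open>m\<^sub>2 - m\<^sub>1\<close> and \<open>m\<^sub>3 - m\<^sub>1\<close>, comparing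
  a monomial of both sides puts \<open>e\<^sub>i - e\<^sub>j\<close> into that lattice.
\<close>

lemma cremona_matrix_map_det:
  assumes "(matrix_map p q r s :: 'k::field tuple3 set) \<in> cremona_maps"
  shows "\<bar>p * s - q * r\<bar> = 1"
proof -
  define m where "m = matrix_exponents p q r s"
  have m: "has_matrix m p q r s" unfolding m_def by (rule has_matrix_matrix_exponents)
  then have mf: "monomial_tuple m \<in> form_tuples"
    by (auto intro: monomial_form_tuples simp: has_matrix_def)
  obtain f g :: "'k tuple3" where f: "dominant f" "ratmap (monomial_tuple m) = ratmap f"
    and g: "dominant g" "ratmap (tuple_comp g f) = ratmap X"
    using assms unfolding matrix_map_def m_def by (rule cremona_mapsE)
  \<comment> \<open>\<open>f\<close> is an arbitrary representative; dominance passes to the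
    monomial one, into which the lattice argument needs to substitute.\<close>
  have md: "dominant (monomial_tuple m :: 'k tuple3)"
    using f ratmap_eq_iff[OF dominant_form_tuples[OF f(1)] mf] dominant_cong[OF _ f(1)] by auto
  define h where "h = tuple_comp g (monomial_tuple m)"
  have "ratmap h = ratmap_comp (ratmap g) (ratmap (monomial_tuple m))"
    unfolding h_def by (rule ratmap_comp_dominant[OF g(1) md, symmetric])
  also have "\<dots> = ratmap X" using g f by (simp add: ratmap_comp_dominant)
  finally have h: "(h, X) \<in> ratmap_rel"
    using ratmap_eq_iff[of h X] dominant_form_tuples[OF dominant_comp[OF g(1) md]]
    by (simp add: h_def)
  obtain d where d: "\<And>i. form d (g i)"
    using dominant_form_tuples[OF g(1)] by (auto simp: form_tuples_def)
  obtain l where "h l \<noteq> 0"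
    using ratmap_rel_form_tuples(1)[OF h] by (auto simp: form_tuples_def)
  \<comment> \<open>One non-zero component suffices, because
    \<open>h l * X i = h i * X l\<close>.\<close>
  then have nz: "h i \<noteq> 0" for i using ratmap_rel_prop[OF h, of l i] by auto
  let ?e = "\<lambda>i::3. Poly_Mapping.single i (1::nat)"
  have "\<exists>a b.
      int (Poly_Mapping.lookup (?e i) 2) - int (Poly_Mapping.lookup (?e 1) 2) = a * p + b * r \<and>
      int (Poly_Mapping.lookup (?e i) 3) - int (Poly_Mapping.lookup (?e 1) 3) = a * q + b * s" for i
  proof -
    have "h i * X 1 \<noteq> 0" using nz by simp
    then obtain w where w: "w \<in> Poly_Mapping.keys (h i * X 1)"
      by (metis keys_eq_empty ex_in_conv)
    then have w': "w \<in> Poly_Mapping.keys (h 1 * X i)"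
      by (simp add: ratmap_rel_prop[OF h])
    have "\<exists>u\<in>Poly_Mapping.keys (h j). w = u + Poly_Mapping.single k 1"
      if "w \<in> Poly_Mapping.keys (h j * X k)" for j k
      using that keys_mult[of "h j" "X k"] by (auto simp: X_def monomial_def)
    from this[OF w] this[OF w'] obtain u v where
      uv: "u \<in> Poly_Mapping.keys (h i)" "w = u + Poly_Mapping.single 1 1"
        "v \<in> Poly_Mapping.keys (h 1)" "w = v + Poly_Mapping.single i 1"
      by blast
    obtain a b where
      ab: "int (Poly_Mapping.lookup u 2) - int (Poly_Mapping.lookup v 2) = a * p + b * r"
        "int (Poly_Mapping.lookup u 3) - int (Poly_Mapping.lookup v 3) = a * q + b * s"
      using form_subst_lattice[OF m d d, of u i v 1] uv
      unfolding h_def tuple_comp_def by blast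
    have "Poly_Mapping.lookup u k + Poly_Mapping.lookup (?e 1) k
        = Poly_Mapping.lookup v k + Poly_Mapping.lookup (?e i) k" for k
      using uv by (metis lookup_add)
    from this[of 2] this[of 3]
    have "int (Poly_Mapping.lookup (?e i) 2) - int (Poly_Mapping.lookup (?e 1) 2)
        = int (Poly_Mapping.lookup u 2) - int (Poly_Mapping.lookup v 2)"
      "int (Poly_Mapping.lookup (?e i) 3) - int (Poly_Mapping.lookup (?e 1) 3)
        = int (Poly_Mapping.lookup u 3) - int (Poly_Mapping.lookup v 3)"
      by linarith+
    with ab show ?thesis by auto
  qed
  \<comment> \<open>In the coordinates 2 and 3, e_2 - e_1 and e_3 - e_1 are the unit vectors. Hence
    the rows (a, b) and (a', b') form an integral left inverse of the matrix, and its determinant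
    divides 1.\<close>
  from this[of 2] this[of 3] obtain a b a' b' where
    *: "1 = a * p + b * r" "0 = a * q + b * s" "0 = a' * p + b' * r" "1 = a' * q + b' * s"
    by (auto simp: lookup_single)
  have "(a * b' - b * a') * (p * s - q * r)
      = (a * p + b * r) * (a' * q + b' * s) - (a * q + b * s) * (a' * p + b' * r)"
    by (simp add: algebra_simps)
  also have "\<dots> = 1" by (simp flip: *)
  finally show ?thesis by (metis abs_zmult_eq_1 abs_1 mult.commute)
qed

section \<open>The Cremona monomial maps as a copy of GL_2(Z)\<close>

lemma cremona_monomial_maps_eq:
  "(cremona_monomial_maps :: 'k::field tuple3 set set) =
    {matrix_map p q r s |p q r s. \<bar>p * s - q * r\<bar> = 1}" (is "?L = ?R")
proof (intro equalityI subsetI)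
  fix F :: "'k tuple3 set" assume F: "F \<in> ?L"
  then obtain m where m: "homogeneous m" "F = ratmap (monomial_tuple m)"
    unfolding cremona_monomial_maps_def homogeneous_def by blast
  obtain p q r s where "has_matrix m p q r s" using m(1) by (rule has_matrix_exists)
  then have "F = matrix_map p q r s" using m ratmap_monomial_tuple by blast
  moreover from this F have "\<bar>p * s - q * r\<bar> = 1"
    by (intro cremona_matrix_map_det[where 'k = 'k]) (simp add: cremona_monomial_maps_def)
  ultimately show "F \<in> ?R" by blast
next
  fix F :: "'k tuple3 set" assume "F \<in> ?R"
  then obtain p q r s where F: "F = matrix_map p q r s" "\<bar>p * s - q * r\<bar> = 1" by blast
  then have "F \<in> cremona_maps" using matrix_map_cremona by simp
  moreover have "\<exists>d. \<forall>i. mdeg (matrix_exponents p q r s i) = d"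
    using has_matrix_matrix_exponents[of p q r s] by (simp add: has_matrix_def homogeneous_def)
  ultimately show "F \<in> ?L"
    unfolding cremona_monomial_maps_def using F(1) matrix_map_def by blast
qed

lemma subgroup_cremona_monomial_maps:
  "subgroup cremona_monomial_maps (cremona_group :: 'k::field tuple3 set monoid)"
proof -
  interpret group "cremona_group :: 'k tuple3 set monoid" by (rule group_cremona_group)
  show ?thesis
  proof (rule subgroupI)
    show "cremona_monomial_maps \<subseteq> carrier (cremona_group :: 'k tuple3 set monoid)"
      by (auto simp: cremona_monomial_maps_def cremona_group_def)
    have "matrix_map 1 0 0 1 \<in> (cremona_monomial_maps :: 'k tuple3 set set)"
      unfolding cremona_monomial_maps_eq by force
    then show "(cremona_monomial_maps :: 'k tuple3 set set) \<noteq> {}" by blast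
  next
    fix F :: "'k tuple3 set" assume "F \<in> cremona_monomial_maps"
    then obtain p q r s where F: "F = matrix_map p q r s" and det: "\<bar>p * s - q * r\<bar> = 1"
      unfolding cremona_monomial_maps_eq by blast
    define e where "e = p * s - q * r"
    \<comment> \<open>The adjugate has determinant \<open>e\<close>, and scaling both of its rows by
      \<open>e\<close> contributes \<open>e * e\<close>.\<close>
    have "\<bar>e * s * (e * p) - - e * q * (- e * r)\<bar> = \<bar>e\<bar> * \<bar>e\<bar> * \<bar>e\<bar>"
      unfolding e_def abs_mult[symmetric] by (simp add: algebra_simps)
    then have det': "\<bar>e * s * (e * p) - - e * q * (- e * r)\<bar> = 1"
      using det by (simp add: e_def)
    have "inv\<^bsub>cremona_group\<^esub> F = matrix_map (e * s) (- e * q) (- e * r) (e * p)"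
      by (rule inv_equality)
         (use matrix_map_inverse(2)[OF det] matrix_map_cremona[OF det] matrix_map_cremona[OF det']
           in \<open>simp_all add: F cremona_group_def e_def\<close>)
    then show "inv\<^bsub>cremona_group\<^esub> F \<in> cremona_monomial_maps"
      unfolding cremona_monomial_maps_eq using det' by blast
  next
    fix F G :: "'k tuple3 set"
    assume "F \<in> cremona_monomial_maps" "G \<in> cremona_monomial_maps"
    then obtain p q r s p' q' r' s' where F: "F = matrix_map p q r s" "\<bar>p * s - q * r\<bar> = 1"
      and G: "G = matrix_map p' q' r' s'" "\<bar>p' * s' - q' * r'\<bar> = 1"
      unfolding cremona_monomial_maps_eq by blast
    have "(p * p' + q * r') * (r * q' + s * s') - (p * q' + q * s') * (r * p' + s * r')
        = (p * s - q * r) * (p' * s' - q' * r')"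
      by (simp add: algebra_simps)
    then have "\<bar>(p * p' + q * r') * (r * q' + s * s') - (p * q' + q * s') * (r * p' + s * r')\<bar> = 1"
      using F G by (simp add: abs_mult)
    moreover have "F \<otimes>\<^bsub>cremona_group\<^esub> G = matrix_map
        (p * p' + q * r') (p * q' + q * s') (r * p' + s * r') (r * q' + s * s')"
      by (simp add: cremona_group_def F G matrix_map_comp)
    ultimately show "F \<otimes>\<^bsub>cremona_group\<^esub> G \<in> cremona_monomial_maps"
      unfolding cremona_monomial_maps_eq by blast
  qed
qed

section \<open>Matrices of the generators\<close>

lemma map_S_eq: "map_S = matrix_map (- 1) 1 0 1"
proof -
  have "triple (X 1 * X 2) (X 1 * X 3) (X 2 * X 3) = (monomial_tuple (triple
     (Poly_Mapping.single 1 1 + Poly_Mapping.single 2 1)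
     (Poly_Mapping.single 1 1 + Poly_Mapping.single 3 1)
     (Poly_Mapping.single 2 1 + Poly_Mapping.single 3 1)) :: 'a tuple3)"
    by (simp add: triple_def fun_eq_iff X_def monomial_add)
  then show ?thesis
    unfolding map_S_def
    by (simp add: ratmap_monomial_tuple has_matrix_def homogeneous_3 mdeg_3 lookup_single lookup_add triple_def)
qed

lemma map_H_eq: "map_H = matrix_map 1 0 1 1"
proof -
  have "triple (X 1 ^ 2) (X 1 * X 2) (X 2 * X 3) = (monomial_tuple (triple
     (Poly_Mapping.single 1 2)
     (Poly_Mapping.single 1 1 + Poly_Mapping.single 2 1)
     (Poly_Mapping.single 2 1 + Poly_Mapping.single 3 1)) :: 'a tuple3)"
    by (simp add: triple_def fun_eq_iff X_power) (simp add: X_def monomial_add)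
  then show ?thesis
    unfolding map_H_def
    by (simp add: ratmap_monomial_tuple has_matrix_def homogeneous_3 mdeg_3 lookup_single lookup_add triple_def)
qed

lemma permutation_tuple_form: "(\<lambda>i. X (\<sigma> i)) \<in> form_tuples"
  using form_X by (force simp: form_tuples_def)

lemma permutation_maps_monomial: "permutation_maps \<subseteq> cremona_monomial_maps"
proof
  fix F :: "'k::field tuple3 set" assume "F \<in> permutation_maps"
  then obtain \<sigma> where F: "F = ratmap (\<lambda>i. X (\<sigma> i))" and \<sigma>: "bij \<sigma>"
    by (auto simp: permutation_maps_def)
  have comp: "ratmap_comp (ratmap (\<lambda>i. X (\<tau> i))) (ratmap (\<lambda>i. X (\<tau>' i))) = (ratmap X :: 'k tuple3 set)"
    if "\<And>i. \<tau>' (\<tau> i) = i" for \<tau> \<tau>'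
  proof -
    have "tuple_comp (\<lambda>i. X (\<tau> i)) (\<lambda>i. X (\<tau>' i)) = (X :: 'k tuple3)"
      by (simp add: tuple_comp_def that)
    then show ?thesis by (subst ratmap_comp_eq) (auto intro: permutation_tuple_form)
  qed
  have "F \<in> cremona_maps"
    unfolding cremona_maps_def F
    using comp[of "inv_into UNIV \<sigma>" \<sigma>] comp[of \<sigma> "inv_into UNIV \<sigma>"] \<sigma>
    by (auto simp: bij_is_inj bij_is_surj surj_f_inv_f intro!: ratmap_in_ratmaps permutation_tuple_form
        bexI[of _ "ratmap (\<lambda>i. X (inv_into UNIV \<sigma> i))"])
  moreover have "\<forall>i. mdeg (Poly_Mapping.single (\<sigma> i) 1) = 1"
    by (simp add: mdeg_def lookup_single when_def)
  ultimately show "F \<in> cremona_monomial_maps"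
    unfolding cremona_monomial_maps_def F X_def
    by (intro CollectI conjI exI[of _ "\<lambda>i. Poly_Mapping.single (\<sigma> i) 1"] exI[of _ 1]) simp_all
qed

text \<open>Serves for the two transpositions used as generators: being an involution gives
  bijectivity at once.\<close>

lemma involution_map_in_permutation_maps:
  assumes "has_matrix (\<lambda>i. Poly_Mapping.single (\<sigma> i) 1) p q r s" "\<forall>i. \<sigma> (\<sigma> i) = i"
  shows "matrix_map p q r s \<in> permutation_maps"
  using ratmap_monomial_tuple[OF assms(1)] assms(2) unfolding permutation_maps_def X_def
  by (auto intro!: exI[of _ \<sigma>] involuntory_imp_bij)

section \<open>Generation of GL_2(Z) by row operations\<close>

text \<open>
  The Euclidean algorithm on the second column makes the matrix lower triangular; then the
  entry below the diagonal is cleared.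
\<close>

lemma GL2_int_induct:
  fixes P :: "int \<Rightarrow> int \<Rightarrow> int \<Rightarrow> int \<Rightarrow> bool"
  assumes one: "P 1 0 0 1"
    and add: "\<And>p q r s. P p q (r + p) (s + q) \<Longrightarrow> P p q r s"
    and diff: "\<And>p q r s. P p q (r - p) (s - q) \<Longrightarrow> P p q r s"
    and swap: "\<And>p q r s. P r s p q \<Longrightarrow> P p q r s"
    and neg: "\<And>p q r s. P (- p) (- q) r s \<Longrightarrow> P p q r s"
    and det: "\<bar>p * s - q * r\<bar> = 1"
  shows "P p q r s"
proof -
  \<comment> \<open>Conjugate the sign change of the first row by the row exchange.\<close>
  have neg2: "P p q (- r) (- s) \<Longrightarrow> P p q r s" for p q r s
    using swap neg by blast
  have lower: "P 1 0 r 1" for r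
  proof (induction "nat \<bar>r\<bar>" arbitrary: r rule: less_induct)
    case less
    consider "r = 0" | "r > 0" | "r < 0" by linarith
    then show ?case
    proof cases
      case 2
      then show ?thesis using less[of "r - 1"] diff[of 1 0 r 1] by simp
    next
      case 3
      then show ?thesis using less[of "r + 1"] add[of 1 0 r 1] by simp
    qed (use one in simp)
  qed
  have diagonal: "P p 0 r s" if "\<bar>p * s\<bar> = 1" for p r s
  proof -
    have "\<bar>p\<bar> = 1" "\<bar>s\<bar> = 1" using that by (metis abs_zmult_eq_1 mult.commute)+
    then have "p = 1 \<or> p = - 1" "s = 1 \<or> s = - 1" by linarith+
    \<comment> \<open>The signs of \<open>p\<close> and \<open>s\<close> are corrected row by row;
      correcting \<open>s\<close> also negates \<open>r\<close>, which is why \<open>lower\<close>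
      is taken at \<open>- r\<close> too.\<close>
    then show ?thesis
      using lower[of r] lower[of "- r"] neg[of p 0 r s] neg2[of 1 0 r s] by auto
  qed
  have "\<bar>p * s - q * r\<bar> = 1 \<Longrightarrow> P p q r s" for p q r s
  proof (induction "nat (\<bar>q\<bar> + \<bar>s\<bar>)" arbitrary: p q r s rule: less_induct)
    case less
    have det: "\<bar>p * s - q * r\<bar> = 1" by (rule less.prems)
    \<comment> \<open>Stated for fresh entries with the same measure, so that it also covers the
      matrix with its rows exchanged.\<close>
    have reduce: "P a b c e"
      if "b \<noteq> 0" "e \<noteq> 0" "\<bar>b\<bar> \<le> \<bar>e\<bar>" "\<bar>b\<bar> + \<bar>e\<bar> = \<bar>q\<bar> + \<bar>s\<bar>" and d: "\<bar>a * e - b * c\<bar> = 1"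
      for a b c e
    proof -
      have pos: "0 < \<bar>q\<bar> + \<bar>s\<bar>" using that by linarith
      show ?thesis
      \<comment> \<open>As 0 < |b| \<le> |e|, subtracting \<open>b\<close> shrinks \<open>e\<close>
        if their signs agree, and adding \<open>b\<close> does so otherwise.\<close>
      proof (cases "\<bar>e - b\<bar> < \<bar>e\<bar>")
        case True
        have "P a b (c - a) (e - b)"
          by (rule less.hyps) (use that True pos in \<open>auto simp: algebra_simps\<close>)
        then show ?thesis by (rule diff)
      next
        case False
        then have "\<bar>e + b\<bar> < \<bar>e\<bar>" using that by linarith
        then have "P a b (c + a) (e + b)"
          by (intro less.hyps) (use that pos in \<open>auto simp: algebra_simps\<close>)
        then show ?thesis by (rule add)
      qed
    qed
    consider "q = 0" | "s = 0" | "q \<noteq> 0" "s \<noteq> 0" "\<bar>q\<bar> \<le> \<bar>s\<bar>" | "q \<noteq> 0" "s \<noteq> 0" "\<bar>s\<bar> \<le> \<bar>q\<bar>"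
      by linarith
    then show ?case
    proof cases
      case 1
      then show ?thesis using det diagonal by simp
    next
      case 2
      then show ?thesis using det diagonal[of r q p] swap by (simp add: mult.commute)
    next
      case 3
      then show ?thesis using det reduce by simp
    next
      case 4
      then have "P r s p q"
        by (intro reduce) (use det in \<open>simp_all add: mult.commute abs_minus_commute\<close>)
      then show ?thesis by (rule swap)
    qed
  qed
  then show ?thesis using det by blast
qed

theorem proposition4p5:
  shows "generate (cremona_group :: 'k::field tuple3 set monoid)
           ({map_S, map_H} \<union> permutation_maps) = cremona_monomial_maps"
proof
  interpret group "cremona_group :: 'k tuple3 set monoid" by (rule group_cremona_group)
  let ?A = "{map_S, map_H} \<union> permutation_maps :: 'k tuple3 set set"
  have "map_S \<in> (cremona_monomial_maps :: 'k tuple3 set set)"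
    "map_H \<in> (cremona_monomial_maps :: 'k tuple3 set set)"
    unfolding cremona_monomial_maps_eq map_S_eq map_H_eq by force+
  then show "generate cremona_group ?A \<subseteq> cremona_monomial_maps"
    using permutation_maps_monomial
    by (intro generate_subgroup_incl subgroup_cremona_monomial_maps) auto
  define P where "P p q r s \<longleftrightarrow> matrix_map p q r s \<in> generate cremona_group ?A" for p q r s
  have comp: "P (p * p' + q * r') (p * q' + q * s') (r * p' + s * r') (r * q' + s * s')"
    if "P p q r s" "P p' q' r' s'" for p q r s p' q' r' s'
    using generate.eng[OF that[unfolded P_def]] by (simp add: P_def cremona_group_def matrix_map_comp)
  have H: "P 1 0 1 1"
    unfolding P_def map_H_eq[symmetric] by (intro generate.incl) simp
  have "inv\<^bsub>cremona_group\<^esub> map_H = (matrix_map 1 0 (- 1) 1 :: 'k tuple3 set)"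
    using matrix_map_cremona[of 1 1 0 1] matrix_map_cremona[of 1 1 0 "- 1"]
    by (intro inv_equality) (simp_all add: cremona_group_def map_H_eq matrix_map_comp matrix_map_1)
  then have H': "P 1 0 (- 1) 1"
    unfolding P_def using generate.inv[of map_H ?A cremona_group] by simp
  have swap: "P 0 1 1 0"
    unfolding P_def
    by (intro generate.incl UnI2 involution_map_in_permutation_maps[of "triple 1 3 2"])
       (simp_all add: has_matrix_def homogeneous_3 mdeg_3 lookup_single triple_def forall_3)
  \<comment> \<open>Exchanging x_1 and x_2 sends (y, z) to (1/y, z/y). Left multiplication by the
    inverse of \<open>map_H\<close> then clears the entry below the diagonal.\<close>
  have "P (- 1) 0 (- 1) 1"
    unfolding P_def
    by (intro generate.incl UnI2 involution_map_in_permutation_maps[of "triple 2 1 3"])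
       (simp_all add: has_matrix_def homogeneous_3 mdeg_3 lookup_single triple_def forall_3)
  from comp[OF H' this] have neg: "P (- 1) 0 0 1" by simp
  have "P p q r s" if "\<bar>p * s - q * r\<bar> = 1" for p q r s
  proof (rule GL2_int_induct[OF _ _ _ _ _ that])
    show "P 1 0 0 1" using comp[OF H H'] by simp
  next
    fix p q r s assume "P p q (r + p) (s + q)"
    \<comment> \<open>Left multiplication by a generator undoes the row operation in the premise:
      the inverse of \<open>map_H\<close> undoes the addition, \<open>map_H\<close> the
      subtraction.\<close>
    from comp[OF H' this] show "P p q r s" by simp
  next
    fix p q r s assume "P p q (r - p) (s - q)"
    from comp[OF H this] show "P p q r s" by simp
  next
    fix p q r s assume "P r s p q"
    from comp[OF swap this] show "P p q r s" by simp
  next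
    fix p q r s assume "P (- p) (- q) r s"
    from comp[OF neg this] show "P p q r s" by simp
  qed
  then show "cremona_monomial_maps \<subseteq> generate cremona_group ?A"
    unfolding cremona_monomial_maps_eq P_def by blast
qed

end
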